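(* Suppose $(X,d)$ is a separable uniform metric space without isolated points, with a uniformly distributed measure $\mu$ such that $\mu(X)<\infty$. Let $G=(V,E)$ be a g.e.c. graph on a dense subset $V$ of $X$. Suppose $\mu$ satisfies $$\lim_{\epsilon\in\mathbb{Q},\,\epsilon\to0}|\mu(B_1(x))-\mu(B_{1+\epsilon}(x))|=0$$ for any (equivalently, some) $x\in V$, and the family $\mathcal{S}:=\{B_{1+\epsilon}(v): v\in V,\ \epsilon\in(-1,1)\cap\mathbb{Q}\}$ is of finite VC-dimension. Then $$\alpha(G)=1/Vl_\mu(X).$$
   Context: $B_r(x)$ denotes the open ball of radius $r$ around $x$. For a graph $G=(V,E)$ and $v\in V$, $N_1(v)$ is the set of vertices adjacent to $v$, and $$\alpha(G):=\inf_{U\subseteq_{\mathrm{fin}}V}\ \sup_{v\in V}\frac{|N_1(v)\cap U|}{|U|}\in[0,1],$$ where $U$ ranges over non-empty finite subsets of $V$. A metric space $(X,d)$ is uniform if there is a uniformly distributed measure $\mu$ on it, i.e. a (Borel) measure with $0<\mu(B_r(x))=\mu(B_r(y))<\infty$ for all real $r>0$ and $x,y\in X$. Its ball volume is $Vl_\mu(X):=\mu(X)/\mu(B_1(x))$ for some (any) $x\in X$. VC-dimension: for a family $\mathcal{F}$ of subsets of $X$, a set $A\subseteq X$ is shattered by $\mathcal{F}$ if every subset of $A$ has the form $F\cap A$ with $F\in\mathcal{F}$; the VC-dimension of $\mathcal{F}$ is the smallest $n$ such that no subset of $X$ of size $n+1$ is shattered (infinite if no such $n$ exists). A (simple, undirected)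 graph $G$ with vertex set a dense $V\subseteq X$ is g.e.c. if (i) any two adjacent $u,v\in V$ satisfy $d(u,v)<1$; and (ii) for any $s\in V$, any disjoint finite $A,B\subseteq V$ contained in $B_1(s)$, and any $\epsilon>0$, there is $v\in V\setminus(A\cup B)$ with $d(s,v)<\epsilon$ adjacent to every vertex in $A$ and to no vertex in $B$. *)

theory Defs
  imports "HOL-Analysis.Analysis" "HOL-Library.Extended_Nat"
begin

text \<open>The metric space \<open>X\<close> is the whole type \<open>'a::metric_space\<close>.\<close>

definition uniformly_distributed :: "'a::metric_space measure \<Rightarrow> bool" where
  "uniformly_distributed \<mu> \<longleftrightarrow>
     sets \<mu> = sets borel \<and>
     (\<forall>r>0. \<forall>x y. 0 < emeasure \<mu> (ball x r) \<and>
                  emeasure \<mu> (ball x r) = emeasure \<mu> (ball y r) \<and>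
                  emeasure \<mu> (ball y r) < \<infinity>)"

text \<open>For uniformly distributed \<open>\<mu>\<close> the choice of the centre is immaterial.\<close>

definition Vl :: "'a::metric_space measure \<Rightarrow> ennreal" where
  "Vl \<mu> = emeasure \<mu> (space \<mu>) / emeasure \<mu> (ball (SOME x. x \<in> space \<mu>) 1)"

definition shatters :: "'a set set \<Rightarrow> 'a set \<Rightarrow> bool" where
  "shatters \<F> A \<longleftrightarrow> (\<forall>B\<subseteq>A. \<exists>F\<in>\<F>. B = F \<inter> A)"

text \<open>The infimum of the empty set in \<^typ>\<open>enat\<close> is \<open>\<infinity>\<close>; and \<open>card A = Suc n\<close> makes \<open>A\<close> finite.\<close>

definition vc_dim :: "'a set set \<Rightarrow> enat" where
  "vc_dim \<F> = Inf {enat n | n. \<not> (\<exists>A. card A = Suc n \<and> shatters \<F> A)}"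

text \<open>
  Simple undirected graphs on a possibly infinite vertex set \<open>V\<close>: \<open>E\<close> is the adjacency relation, so
  each edge occurs in both orientations and \<open>E `` {v}\<close> is the set of neighbours of \<open>v\<close>.
\<close>

definition simple_graph :: "'a set \<Rightarrow> 'a rel \<Rightarrow> bool" where
  "simple_graph V E \<longleftrightarrow> E \<subseteq> V \<times> V \<and> sym E \<and> irrefl E"

text \<open>
  For \<open>V \<noteq> {}\<close> the infimum and the suprema are over non-empty families of numbers in \<open>[0,1]\<close>,
  so they are genuine infima and suprema of reals.
\<close>

definition graph_alpha :: "'a set \<Rightarrow> 'a rel \<Rightarrow> real" where
  "graph_alpha V E =
     (INF U\<in>{U. U \<subseteq> V \<and> finite U \<and> U \<noteq> {}}.
        SUP v\<in>V. real (card (E `` {v} \<inter> U)) / real (card U))"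

definition gec :: "'a::metric_space set \<Rightarrow> 'a rel \<Rightarrow> bool" where
  "gec V E \<longleftrightarrow>
     closure V = UNIV \<and> simple_graph V E \<and>
     (\<forall>u\<in>V. \<forall>v\<in>V. (u, v) \<in> E \<longrightarrow> dist u v < 1) \<and>
     (\<forall>s\<in>V. \<forall>A B. \<forall>\<epsilon>>0.
        finite A \<and> finite B \<and> A \<subseteq> V \<and> B \<subseteq> V \<and> A \<inter> B = {} \<and>
        A \<subseteq> ball s 1 \<and> B \<subseteq> ball s 1 \<longrightarrow>
        (\<exists>v\<in>V - (A \<union> B). dist s v < \<epsilon> \<and>
           (\<forall>a\<in>A. (v, a) \<in> E) \<and> (\<forall>b\<in>B. (v, b) \<notin> E)))"

end

theory Submission
  imports Defs
begin

text \<open>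
  For the lower bound, averaging \<open>card (U \<inter> ball x 1)\<close> over \<open>x\<close> produces a unit ball that captures
  at least the fraction \<open>1 / Vl \<mu>\<close> of \<open>U\<close>; moving its centre slightly into \<open>V\<close>, the extension
  property of \<open>G\<close> turns the captured points into common neighbours of one vertex.

  For the upper bound, a finite uniformly distributed measure forces the space to be totally bounded,
  because separated points carry disjoint balls of equal mass. Cut the space into finitely many pieces of small diameter and place in the vicinity of
  each piece a number of points of \<open>V\<close> proportional to its mass. A unit ball then contains at most
  the share of points given by the mass of a slightly larger ball, and the continuity assumption
  lets the enlargement tend to zero.
\<close>

section \<open>Uniformly distributed measures and total boundedness\<close>

lemma uniformly_distributedD:
  assumes "uniformly_distributed \<mu>"
  shows "sets \<mu> = sets borel" "space \<mu> = UNIV"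
    and "0 < r \<Longrightarrow> 0 < emeasure \<mu> (ball x r)"
    and "0 < r \<Longrightarrow> emeasure \<mu> (ball x r) = emeasure \<mu> (ball y r)"
    and "0 < r \<Longrightarrow> measure \<mu> (ball x r) = measure \<mu> (ball y r)"
proof -
  show s: "sets \<mu> = sets borel"
    using assms unfolding uniformly_distributed_def by blast
  show "space \<mu> = UNIV"
    using sets_eq_imp_space_eq[OF s] by simp
  show "0 < r \<Longrightarrow> 0 < emeasure \<mu> (ball x r)"
    using assms unfolding uniformly_distributed_def by blast
  show eq: "0 < r \<Longrightarrow> emeasure \<mu> (ball x r) = emeasure \<mu> (ball y r)"
    using assms unfolding uniformly_distributed_def by blast
  show "0 < r \<Longrightarrow> measure \<mu> (ball x r) = measure \<mu> (ball y r)"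
    using eq by (simp add: measure_def)
qed

lemma uniformly_distributed_measure_pos:
  assumes "uniformly_distributed \<mu>" "finite_measure \<mu>" "0 < r"
  shows "0 < measure \<mu> (ball x r)"
proof -
  interpret finite_measure \<mu> by fact
  show ?thesis
    using uniformly_distributedD(3)[OF assms(1,3), of x]
    by (simp add: emeasure_eq_measure)
qed

text \<open>An \<open>e\<close>-separated set of largest size is a net, since a point outside all
  its balls could be added to it. A largest one exists because the balls of radius
  \<open>e/2\<close> around separated points are disjoint and share one positive mass, which bounds
  their number.\<close>

lemma uniformly_distributed_finite_net:
  fixes \<mu> :: "'a::metric_space measure"
  assumes ud: "uniformly_distributed \<mu>" and fm: "finite_measure \<mu>" and e: "0 < e"
  obtains K :: "'a set" where "finite K" "(\<Union>k\<in>K. ball k e) = UNIV"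
proof -
  interpret finite_measure \<mu> by fact
  note [measurable_cong, simp] = uniformly_distributedD(1)[OF ud]
  define sep :: "'a set \<Rightarrow> bool"
    where "sep S \<longleftrightarrow> finite S \<and> (\<forall>x\<in>S. \<forall>y\<in>S. x \<noteq> y \<longrightarrow> e \<le> dist x y)" for S
  \<comment> \<open>The centre \<open>undefined\<close> is an arbitrary point; \<open>c_eq\<close>
    makes the choice irrelevant.\<close>
  define c where "c = measure \<mu> (ball undefined (e/2))"
  have c_eq: "measure \<mu> (ball x (e/2)) = c" for x
    unfolding c_def using e by (intro uniformly_distributedD(5)[OF ud]) simp
  have c: "0 < c"
    unfolding c_def using uniformly_distributed_measure_pos[OF ud fm] e by simp
  have bound: "real (card S) * c \<le> measure \<mu> (space \<mu>)" if "sep S" for S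
  proof -
    have disj: "disjoint_family_on (\<lambda>x. ball x (e/2)) S"
      unfolding disjoint_family_on_def
    proof (intro ballI impI)
      fix x y assume "x \<in> S" "y \<in> S" "x \<noteq> y"
      then have "e \<le> dist x y" using that by (auto simp: sep_def)
      then show "ball x (e/2) \<inter> ball y (e/2) = {}"
        by (intro disjoint_ballI) simp
    qed
    have "real (card S) * c = (\<Sum>x\<in>S. measure \<mu> (ball x (e/2)))"
      by (simp add: c_eq)
    also have "\<dots> = measure \<mu> (\<Union>x\<in>S. ball x (e/2))"
      using that disj by (intro finite_measure_finite_Union[symmetric]) (auto simp: sep_def)
    also have "\<dots> \<le> measure \<mu> (space \<mu>)"
      by (rule bounded_measure)
    finally show ?thesis .
  qed
  obtain N :: nat where N: "measure \<mu> (space \<mu>) / c < real N"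
    using reals_Archimedean2 by blast
  have "card S < N" if "sep S" for S
  proof -
    have "real (card S) \<le> measure \<mu> (space \<mu>) / c"
      using bound[OF that] c by (simp add: field_simps)
    then show ?thesis using N by linarith
  qed
  moreover have "sep {}" by (simp add: sep_def)
  ultimately obtain S where S: "sep S" "\<And>T. sep T \<Longrightarrow> card T \<le> card S"
    using ex_has_greatest_nat[of sep "{}" card N] by blast
  have "\<exists>k\<in>S. x \<in> ball k e" for x
  proof (rule ccontr)
    assume "\<not> ?thesis"
    then have far: "\<forall>k\<in>S. e \<le> dist k x" by (auto simp: not_less)
    then have "x \<notin> S" using e by auto
    moreover have "finite S" using S(1) by (simp add: sep_def)
    ultimately have "card (insert x S) = Suc (card S)" by simp
    moreover have "sep (insert x S)"
      using S(1) far by (auto simp: sep_def dist_commute)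
    ultimately show False
      using S(2)[of "insert x S"] by simp
  qed
  then show thesis
    using S(1) by (intro that[of S]) (auto simp: sep_def)
qed

section \<open>Finite sets of vertices that imitate the measure\<close>

text \<open>Greedy choice: the finitely many points already taken leave the next set infinite.
  Disjointness lets cardinalities add up even when the sets \<open>S i\<close> overlap.\<close>

lemma disjoint_subsets_of_infinite_sets:
  fixes m :: "nat \<Rightarrow> nat"
  assumes "\<And>i. i < n \<Longrightarrow> infinite (S i)"
  shows "\<exists>W. disjoint_family_on W {..<n} \<and> (\<forall>i<n. W i \<subseteq> S i \<and> finite (W i) \<and> card (W i) = m i)"
  using assms
proof (induction n)
  case 0
  then show ?case by (simp add: disjoint_family_on_def)
next
  case (Suc n)
  then obtain W where W: "disjoint_family_on W {..<n}"
      "\<forall>i<n. W i \<subseteq> S i \<and> finite (W i) \<and> card (W i) = m i"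
    by auto
  have "infinite (S n - (\<Union>i<n. W i))"
    using Suc.prems[of n] W(2) by (intro Diff_infinite_finite) auto
  then obtain T where T: "T \<subseteq> S n - (\<Union>i<n. W i)" "finite T" "card T = m n"
    using infinite_arbitrarily_large[of _ "m n"] by metis
  have "disjoint_family_on (W(n := T)) {..<Suc n}"
    using W(1) T(1) unfolding lessThan_Suc
    by (simp add: disjoint_family_on_def) blast
  moreover have "\<forall>i<Suc n. (W(n := T)) i \<subseteq> S i \<and> finite ((W(n := T)) i) \<and> card ((W(n := T)) i) = m i"
    using W(2) T by (auto simp: less_Suc_eq)
  ultimately show ?case by blast
qed

text \<open>\<open>U\<close> discretises \<mu>: up to \<delta>, the share of \<open>U\<close> in a
  unit ball is at most the mass share of the ball enlarged by \<open>e\<close>. One \<open>U\<close>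
  serves all centres \<open>v\<close>, as a bound on the supremum over \<open>v\<close>
  requires.\<close>

lemma approximating_finite_subset:
  fixes \<mu> :: "'a::metric_space measure"
  assumes ud: "uniformly_distributed \<mu>" and fm: "finite_measure \<mu>"
    and iso: "\<forall>x::'a. \<not> x isolated_in UNIV" and dense: "closure V = UNIV"
    and e: "0 < e" and \<delta>: "0 < \<delta>"
  obtains U where "U \<subseteq> V" "finite U" "U \<noteq> {}"
    and "\<And>v. measure \<mu> (space \<mu>) * real (card (ball v 1 \<inter> U)) \<le>
              (measure \<mu> (ball v (1 + e)) + \<delta>) * real (card U)"
proof -
  interpret finite_measure \<mu> by fact
  note [measurable_cong, simp] = uniformly_distributedD(1,2)[OF ud]
  define M where "M = measure \<mu> UNIV"
  have M: "0 < M"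
    using less_le_trans[OF uniformly_distributed_measure_pos[OF ud fm, of 1] bounded_measure]
    by (simp add: M_def)
  obtain K where K: "finite K" "(\<Union>k\<in>K. ball k (e/2)) = (UNIV :: 'a set)"
    by (rule uniformly_distributed_finite_net[OF ud fm half_gt_zero[OF e]])
  obtain k and n :: nat where k: "K = k ` {i. i < n}"
    using K(1) finite_imp_nat_seg_image_inj_on by metis
  \<comment> \<open>Disjoint pieces make the masses add up to \<open>M\<close>. The points of
    \<open>U\<close> are later drawn from the surrounding balls, because a piece itself may miss
    \<open>V\<close>.\<close>
  define P where "P = disjointed (\<lambda>i. ball (k i) (e/2))"
  have P_sub: "P i \<subseteq> ball (k i) (e/2)" for i
    unfolding P_def by (rule disjointed_subset)
  have P_sets [measurable, simp]: "P i \<in> sets borel" for i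
    unfolding P_def disjointed_def by auto
  have P_disj: "disjoint_family P"
    unfolding P_def by (rule disjoint_family_disjointed)
  have P_cover: "(\<Union>i<n. P i) = UNIV"
    using finite_UN_disjointed_eq[of "\<lambda>i. ball (k i) (e/2)" n] K(2) k
    by (auto simp: P_def atLeast0LessThan lessThan_def)
  have P_sum: "(\<Sum>i\<in>I. measure \<mu> (P i)) = measure \<mu> (\<Union>i\<in>I. P i)" if "finite I" for I
    using that P_disj
    by (intro finite_measure_finite_Union[symmetric])
      (auto intro: disjoint_family_on_mono[of I UNIV])
  \<comment> \<open>\<open>N\<close> is the number of points per unit of mass. Rounding costs at
    most one point per piece, hence \<open>n\<close> in total, which this choice keeps below
    \<delta> times \<open>N\<close>.\<close>
  obtain N :: nat where "real n / \<delta> < real N"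
    using reals_Archimedean2 by blast
  then have N: "real n < \<delta> * real N" and N_pos: "0 < N"
    using \<delta> by (auto simp: field_simps intro: gr0I)
  define m where "m i = nat \<lceil>real N * measure \<mu> (P i)\<rceil>" for i
  have m_ge: "real N * measure \<mu> (P i) \<le> real (m i)"
    and m_le: "real (m i) \<le> real N * measure \<mu> (P i) + 1" for i
    unfolding m_def by (auto simp: real_nat_ceiling_ge)
  \<comment> \<open>Without isolated points, every point is a limit point of the closure of
    \<open>V\<close>, hence of \<open>V\<close>.\<close>
  have "infinite (V \<inter> ball x r)" if "0 < r" for x r
  proof -
    have "x islimpt closure V"
      using iso dense by (simp add: isolated_in_islimpt_iff)
    then have "x islimpt V"
      by (simp only: limpt_of_closure)
    then show ?thesis
      using that by (simp add: islimpt_eq_infinite_ball)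
  qed
  then obtain W where W_disj: "disjoint_family_on W {..<n}"
    and W: "\<And>i. i < n \<Longrightarrow> W i \<subseteq> V \<inter> ball (k i) (e/2)"
      "\<And>i. i < n \<Longrightarrow> finite (W i)" "\<And>i. i < n \<Longrightarrow> card (W i) = m i"
    using disjoint_subsets_of_infinite_sets[of n "\<lambda>i. V \<inter> ball (k i) (e/2)" m] e by auto
  define U where "U = (\<Union>i<n. W i)"
  have fin: "finite U" using W by (auto simp: U_def)
  have card_U: "real N * M \<le> real (card U)"
  proof -
    have "real N * M = (\<Sum>i<n. real N * measure \<mu> (P i))"
      using P_sum[of "{..<n}"] P_cover by (simp add: M_def sum_distrib_left[symmetric])
    also have "\<dots> \<le> (\<Sum>i<n. real (m i))"
      by (intro sum_mono m_ge)
    also have "\<dots> = real (card U)"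
      unfolding U_def using W W_disj
      by (subst card_UN_disjoint) (auto simp: disjoint_family_on_def)
    finally show ?thesis .
  qed
  have card_ball: "real (card (ball v 1 \<inter> U)) \<le> real N * measure \<mu> (ball v (1 + e)) + real n" for v
  proof -
    define I where "I = {i. i < n \<and> ball v 1 \<inter> W i \<noteq> {}}"
    have I: "finite I" "I \<subseteq> {..<n}" by (auto simp: I_def)
    \<comment> \<open>A point of \<open>W i\<close> and a point of \<open>P i\<close> lie in the
      same ball of radius \<open>e/2\<close>, so they are less than \<open>e\<close> apart.\<close>
    have sub: "(\<Union>i\<in>I. P i) \<subseteq> ball v (1 + e)"
    proof
      fix x assume "x \<in> (\<Union>i\<in>I. P i)"
      then obtain i u where iu: "i < n" "u \<in> W i" "dist v u < 1" "x \<in> P i"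
        by (auto simp: I_def)
      have "dist (k i) u < e/2" "dist (k i) x < e/2"
        using W(1) P_sub iu by fastforce+
      then have "dist u x < e" by metric
      then show "x \<in> ball v (1 + e)" using iu(3) by simp metric
    qed
    have "card (ball v 1 \<inter> U) \<le> card (\<Union>i\<in>I. W i)"
      using I W by (intro card_mono) (auto simp: U_def I_def)
    also have "\<dots> \<le> (\<Sum>i\<in>I. card (W i))"
      using I by (intro card_UN_le)
    also have "\<dots> = (\<Sum>i\<in>I. m i)"
      using I W by (intro sum.cong) auto
    finally have "real (card (ball v 1 \<inter> U)) \<le> (\<Sum>i\<in>I. real (m i))"
      by (metis of_nat_le_iff of_nat_sum)
    also have "\<dots> \<le> (\<Sum>i\<in>I. real N * measure \<mu> (P i) + 1)"
      by (intro sum_mono m_le)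
    also have "\<dots> = real N * measure \<mu> (\<Union>i\<in>I. P i) + real (card I)"
      using I by (simp add: sum.distrib sum_distrib_left[symmetric] P_sum)
    also have "\<dots> \<le> real N * measure \<mu> (ball v (1 + e)) + real n"
      using sub card_mono[OF _ I(2)]
      by (intro add_mono mult_left_mono finite_measure_mono) auto
    finally show ?thesis .
  qed
  show thesis
  proof (rule that[of U])
    show "U \<subseteq> V" using W(1) by (auto simp: U_def)
    show "finite U" by fact
    show "U \<noteq> {}" using card_U N_pos M by (auto simp: mult_le_0_iff)
    fix v
    have "M * real (card (ball v 1 \<inter> U)) \<le> M * (real N * measure \<mu> (ball v (1 + e)) + \<delta> * real N)"
      using card_ball[of v] N M by (intro mult_left_mono) auto
    also have "\<dots> = (measure \<mu> (ball v (1 + e)) + \<delta>) * (real N * M)"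
      by (simp add: algebra_simps)
    also have "\<dots> \<le> (measure \<mu> (ball v (1 + e)) + \<delta>) * real (card U)"
      using card_U \<delta> by (intro mult_left_mono) auto
    finally show "measure \<mu> (space \<mu>) * real (card (ball v 1 \<inter> U)) \<le>
        (measure \<mu> (ball v (1 + e)) + \<delta>) * real (card U)"
      by (simp add: M_def)
  qed
qed

section \<open>Capturing many points by a unit ball and by a neighbourhood\<close>

text \<open>Double counting: integrating the number of captured points over all centres gives the
  sum of the masses of the unit balls around \<open>U\<close>, and a maximum is at least the
  average.\<close>

lemma unit_ball_capturing_average:
  fixes \<mu> :: "'a::metric_space measure" and U :: "'a set"
  assumes ud: "uniformly_distributed \<mu>" and fm: "finite_measure \<mu>" and U: "finite U"
  obtains x where "real (card U) * measure \<mu> (ball y 1) \<le>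
    measure \<mu> (space \<mu>) * real (card (ball x 1 \<inter> U))"
proof -
  interpret finite_measure \<mu> by fact
  note [measurable_cong, simp] = uniformly_distributedD(1,2)[OF ud]
  define f where "f x = card (ball x 1 \<inter> U)" for x
  \<comment> \<open>Bounded natural values attain a maximum.\<close>
  have "f z < Suc (card U)" for z
    unfolding f_def less_Suc_eq_le using U by (intro card_mono) auto
  then obtain x where x: "\<And>z. f z \<le> f x"
    using ex_has_greatest_nat[of "\<lambda>_. True" undefined f "Suc (card U)"] by blast
  have f_eq: "real (f z) = (\<Sum>u\<in>U. indicator (ball u 1) z)" for z
  proof -
    have "(\<Sum>u\<in>U. indicator (ball u 1) z :: real) = (\<Sum>u\<in>U. if u \<in> ball z 1 then 1 else 0)"
      by (intro sum.cong) (auto simp: indicator_def dist_commute)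
    also have "\<dots> = real (f z)"
      using U by (simp add: f_def sum.If_cases Int_def conj_commute)
    finally show ?thesis ..
  qed
  have int: "integrable \<mu> (indicator (ball u 1) :: 'a \<Rightarrow> real)" for u
    by (intro integrable_real_indicator) (auto simp: emeasure_eq_measure)
  have int_f: "integrable \<mu> (\<lambda>z. real (f z))"
    unfolding f_eq using int by (intro Bochner_Integration.integrable_sum) auto
  have "real (card U) * measure \<mu> (ball y 1) = (\<Sum>u\<in>U. measure \<mu> (ball y 1))"
    by simp
  also have "\<dots> = (\<Sum>u\<in>U. measure \<mu> (ball u 1))"
    by (intro sum.cong refl uniformly_distributedD(5)[OF ud]) simp
  also have "\<dots> = (\<integral>z. real (f z) \<partial>\<mu>)"
    unfolding f_eq using int by (subst Bochner_Integration.integral_sum) auto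
  also have "\<dots> \<le> (\<integral>z. real (f x) \<partial>\<mu>)"
    using x int_f by (intro integral_mono) auto
  also have "\<dots> = measure \<mu> (space \<mu>) * real (f x)"
    by simp
  finally show thesis
    using that by (simp add: f_def)
qed

text \<open>The extension property needs a centre in \<open>V\<close>. Finitely many points of an
  open ball stay inside it when its centre moves slightly, so density provides one.\<close>

lemma gec_common_neighbour:
  assumes "gec V E" "finite U" "U \<subseteq> V"
  obtains v where "v \<in> V" "ball x 1 \<inter> U \<subseteq> E `` {v}"
proof -
  \<comment> \<open>By symmetry of the distance, these are the centres whose unit balls contain all
    of \<open>ball x 1 \<inter> U\<close>.\<close>
  define O' where "O' = (\<Inter>a\<in>ball x 1 \<inter> U. ball a 1)"
  have "open O'" "x \<in> O'"
    using assms(2) by (auto simp: O'_def dist_commute intro!: open_INT)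
  moreover have "x \<in> closure V"
    using assms(1) by (simp add: gec_def)
  ultimately obtain s where s: "s \<in> V" "s \<in> O'"
    by (meson closure_iff_nhds_not_empty disjoint_iff subset_refl)
  have "ball x 1 \<inter> U \<subseteq> ball s 1"
    using s(2) by (auto simp: O'_def dist_commute)
  moreover have "finite (ball x 1 \<inter> U)" "ball x 1 \<inter> U \<subseteq> V"
    using assms by auto
  \<comment> \<open>Extension property with the captured points as \<open>A\<close>, the empty set
    as \<open>B\<close> and \<epsilon> equal to 1.\<close>
  ultimately obtain v where "v \<in> V" "\<forall>a\<in>ball x 1 \<inter> U. (v, a) \<in> E"
    using assms(1) s(1) unfolding gec_def
    by (metis DiffD1 Int_empty_right empty_subsetI finite.emptyI zero_less_one)
  then show thesis using that by blast
qed

section \<open>Evaluation of \<open>graph_alpha\<close> by two inequalities\<close>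

theorem theorem4p8:
  fixes \<mu> :: "'a::metric_space measure" and V :: "'a set" and E :: "'a rel"
  assumes "separable_space (euclidean :: 'a topology)"
    and "\<forall>x::'a. \<not> x isolated_in UNIV"
    and "uniformly_distributed \<mu>"
    and "emeasure \<mu> (space \<mu>) < \<infinity>"
    and "gec V E"
    and "\<forall>x\<in>V. ((\<lambda>\<epsilon>. \<bar>measure \<mu> (ball x 1) - measure \<mu> (ball x (1 + \<epsilon>))\<bar>) \<longlongrightarrow> 0) (at 0 within \<rat>)"
    and "vc_dim {ball v (1 + \<epsilon>) | v \<epsilon>. v \<in> V \<and> \<epsilon> \<in> {-1<..<1} \<inter> \<rat>} < \<infinity>"
  shows "graph_alpha V E = 1 / enn2real (Vl \<mu>)"
proof -
  note ud = assms(3) and gec = assms(5)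
  have fm: "finite_measure \<mu>"
    using assms(4) by (intro finite_measureI) auto
  interpret finite_measure \<mu> by fact
  note [measurable_cong, simp] = uniformly_distributedD(1,2)[OF ud]
  have dense: "closure V = UNIV"
    using gec by (simp add: gec_def)
  then obtain x0 where x0: "x0 \<in> V"
    by (metis UNIV_not_empty closure_empty ex_in_conv)
  define M c where "M = measure \<mu> UNIV" and "c = measure \<mu> (ball x0 1)"
  have c: "0 < c"
    unfolding c_def using uniformly_distributed_measure_pos[OF ud fm] by simp
  have M: "0 < M"
    using c bounded_measure[of "ball x0 1"] by (simp add: M_def c_def)
  have c_eq: "measure \<mu> (ball x 1) = c" for x
    unfolding c_def using uniformly_distributedD(5)[OF ud] by simp
  have "enn2real (Vl \<mu>) = M / c"
    using c M by (simp add: Vl_def emeasure_eq_measure c_eq divide_ennreal M_def)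
  then have goal: "1 / enn2real (Vl \<mu>) = c / M"
    by simp
  define \<U> where "\<U> = {U. U \<subseteq> V \<and> finite U \<and> U \<noteq> {}}"
  define r where "r U v = real (card (E `` {v} \<inter> U)) / real (card U)" for U v
  have alpha: "graph_alpha V E = (INF U\<in>\<U>. SUP v\<in>V. r U v)"
    by (simp add: graph_alpha_def \<U>_def r_def)
  \<comment> \<open>Real suprema dominate their members only for families bounded above.\<close>
  have bdd: "bdd_above (r U ` V)" if "U \<in> \<U>" for U
  proof (intro bdd_aboveI2)
    fix v
    have "card (E `` {v} \<inter> U) \<le> card U"
      using that by (intro card_mono) (auto simp: \<U>_def)
    then show "r U v \<le> 1"
      by (auto simp: r_def divide_le_eq_1)
  qed
  have lower: "c / M \<le> (SUP v\<in>V. r U v)" if U: "U \<in> \<U>" for U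
  proof -
    have fin: "finite U" "U \<subseteq> V" and pos: "0 < card U"
      using U by (auto simp: \<U>_def card_gt_0_iff)
    obtain x where x: "real (card U) * c \<le> M * real (card (ball x 1 \<inter> U))"
      using unit_ball_capturing_average[OF ud fm fin(1), of x0] by (auto simp: c_def M_def)
    obtain v where v: "v \<in> V" "ball x 1 \<inter> U \<subseteq> E `` {v}"
      using gec_common_neighbour[OF gec fin] by blast
    have "card (ball x 1 \<inter> U) \<le> card (E `` {v} \<inter> U)"
      using v fin by (intro card_mono) auto
    then have "M * real (card (ball x 1 \<inter> U)) \<le> M * real (card (E `` {v} \<inter> U))"
      using M by simp
    with x have "real (card U) * c \<le> M * real (card (E `` {v} \<inter> U))"
      by (rule order_trans)
    then have "c / M \<le> r U v"
      using M pos by (simp add: r_def field_simps)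
    also have "\<dots> \<le> (SUP v\<in>V. r U v)"
      using bdd[OF U] v(1) by (intro cSUP_upper)
    finally show ?thesis .
  qed
  have upper: "(INF U\<in>\<U>. SUP v\<in>V. r U v) \<le> c / M + \<eta>" if \<eta>: "0 < \<eta>" for \<eta>
  proof -
    \<comment> \<open>One half of \<eta> times \<open>M\<close> pays for the discretisation, the
      other for enlarging the unit ball.\<close>
    define \<delta> where "\<delta> = \<eta> * M / 2"
    have \<delta>: "0 < \<delta>" using \<eta> M by (simp add: \<delta>_def)
    obtain d where d: "0 < d"
      "\<And>e. e \<in> \<rat> \<Longrightarrow> e \<noteq> 0 \<Longrightarrow> \<bar>e\<bar> < d \<Longrightarrow> \<bar>c - measure \<mu> (ball x0 (1 + e))\<bar> < \<delta>"
      using tendstoD[OF assms(6)[rule_format, OF x0] \<delta>]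
      by (auto simp: eventually_at c_def)
    \<comment> \<open>The limit runs through rational radii, so \<open>e\<close> is taken
      rational.\<close>
    obtain e where e: "e \<in> \<rat>" "0 < e" "e < d"
      using Rats_dense_in_real[OF d(1)] by blast
    obtain U where U: "U \<subseteq> V" "finite U" "U \<noteq> {}" and
      le: "\<And>v. M * real (card (ball v 1 \<inter> U)) \<le> (measure \<mu> (ball v (1 + e)) + \<delta>) * real (card U)"
      using approximating_finite_subset[OF ud fm assms(2) dense e(2) \<delta>] unfolding M_def by auto
    have pos: "0 < card U" using U by (auto simp: card_gt_0_iff)
    have "(INF U\<in>\<U>. SUP v\<in>V. r U v) \<le> (SUP v\<in>V. r U v)"
      using U lower by (intro cINF_lower bdd_belowI2) (auto simp: \<U>_def)
    also have "\<dots> \<le> c / M + \<eta>"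
    proof (intro cSUP_least)
      show "V \<noteq> {}" using x0 by blast
      \<comment> \<open>Edges are shorter than 1, so all neighbours of \<open>v\<close> lie in its
        unit ball.\<close>
      fix v assume "v \<in> V"
      then have "E `` {v} \<subseteq> ball v 1"
        using gec by (auto simp: gec_def simple_graph_def)
      then have "card (E `` {v} \<inter> U) \<le> card (ball v 1 \<inter> U)"
        using U by (intro card_mono) auto
      then have "M * real (card (E `` {v} \<inter> U)) \<le> M * real (card (ball v 1 \<inter> U))"
        using M by simp
      also note le[of v]
      \<comment> \<open>Uniform distribution carries the estimate at \<open>x0\<close> over to every
        \<open>v\<close>.\<close>
      also have "measure \<mu> (ball v (1 + e)) = measure \<mu> (ball x0 (1 + e))"
        using uniformly_distributedD(5)[OF ud] e by simp
      also have "(measure \<mu> (ball x0 (1 + e)) + \<delta>) * real (card U) \<le> (c + \<eta> * M) * real (card U)"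
      proof (intro mult_right_mono)
        show "measure \<mu> (ball x0 (1 + e)) + \<delta> \<le> c + \<eta> * M"
          using d(2)[of e] e unfolding \<delta>_def by (simp add: abs_if split: if_splits)
      qed simp
      finally show "r U v \<le> c / M + \<eta>"
        using M pos by (simp add: r_def field_simps)
    qed
    finally show ?thesis .
  qed
  \<comment> \<open>A lower bound passes to a real infimum only over a non-empty family.\<close>
  have "{x0} \<in> \<U>" using x0 by (simp add: \<U>_def)
  then have "c / M \<le> (INF U\<in>\<U>. SUP v\<in>V. r U v)"
    using lower by (intro cINF_greatest) auto
  moreover have "(INF U\<in>\<U>. SUP v\<in>V. r U v) \<le> c / M"
    using upper by (rule field_le_epsilon)
  ultimately show ?thesis
    by (simp add: alpha goal)
qed

end
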